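(* Let $X$ be a real Hilbert space and let $A,B$ be nonempty closed convex subsets of $X$. Suppose that the interior of $A\cap B$ is nonempty. Then the couple $(A,B)$ is stable.
   Context: For a nonempty closed convex set $K\subset X$, $P_K$ denotes the metric projection onto $K$. Perturbed alternating projections sequences: given $a_0\in X$ and sequences $\{A_n\},\{B_n\}$ of nonempty closed convex sets, they are defined inductively by $b_n=P_{B_n}(a_{n-1})$ and $a_n=P_{A_n}(b_n)$ for $n\in\mathbb{N}=\{1,2,\dots\}$. Attouch-Wets convergence: let $B_X$ be the closed unit ball. For nonempty closed $A,C\subset X$ and $N\in\mathbb{N}$ put $e_N(A,C)=\sup\{\mathrm{dist}(a,C): a\in A,\ \|a\|\le N\}$ (equal to $0$ if $A\cap NB_X=\emptyset$) and $h_N(A,C)=\max\{e_N(A,C),e_N(C,A)\}$. A sequence $\{A_n\}$ of nonempty closed sets Attouch-Wets converges to the nonempty closed set $A$ if $\lim_n h_N(A_n,A)=0$ for every $N\in\mathbb{N}$. Stability: let $A,B$ be closed convex subsets of $X$ with $A\cap B\neq\emptyset$. The couple $(A,B)$ is stable if for each choice of sequences $\{A_n\},\{B_n\}$ of nonempty closed convex sets converging for the Attouch-Wets convergence to $A$ and $B$, respectively, and for each choice of the starting point $a_0\in X$, the corresponding perturbed alternating projections sequences $\{a_n\}$ and $\{b_n\}$ converge in norm. *)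

theory Defs
  imports "HOL-Analysis.Analysis"
begin

text \<open>
  Real Hilbert spaces are types of sort \<open>{real_inner, banach}\<close>. The library's \<open>closest_point\<close>
  is restricted to types of class \<open>heine_borel\<close>, hence to finite dimension, and cannot be
  used here.
\<close>

definition metric_projection :: "'a::metric_space set \<Rightarrow> 'a \<Rightarrow> 'a" where
  "metric_projection K x = (THE y. y \<in> K \<and> (\<forall>z\<in>K. dist x y \<le> dist x z))"

text \<open>
  The case distinction is needed because \<open>Sup {}\<close> is unspecified on the reals. If \<open>C\<close> is
  nonempty, the supremum is over a set bounded above, and \<open>infdist a C\<close> is the distance
  from \<open>a\<close> to \<open>C\<close>.
\<close>

definition aw_excess :: "nat \<Rightarrow> 'a::real_normed_vector set \<Rightarrow> 'a set \<Rightarrow> real" where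
  "aw_excess N A C =
     (if A \<inter> cball 0 (real N) = {} then 0
      else (SUP a\<in>{a\<in>A. norm a \<le> real N}. infdist a C))"

definition aw_dist :: "nat \<Rightarrow> 'a::real_normed_vector set \<Rightarrow> 'a set \<Rightarrow> real" where
  "aw_dist N A C = max (aw_excess N A C) (aw_excess N C A)"

text \<open>Intended for nonempty closed sets.\<close>

definition aw_converges :: "(nat \<Rightarrow> 'a::real_normed_vector set) \<Rightarrow> 'a set \<Rightarrow> bool" where
  "aw_converges As A \<longleftrightarrow> (\<forall>N\<ge>1. (\<lambda>n. aw_dist N (As n) A) \<longlonglongrightarrow> 0)"

text \<open>
  The sequences of sets and the sequence \<open>b\<close> are indexed by \<open>1, 2, \<dots>\<close>; their entries at
  index \<open>0\<close> play no role.
\<close>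

primrec perturbed_a ::
  "(nat \<Rightarrow> 'a::metric_space set) \<Rightarrow> (nat \<Rightarrow> 'a set) \<Rightarrow> 'a \<Rightarrow> nat \<Rightarrow> 'a" where
  "perturbed_a As Bs a0 0 = a0"
| "perturbed_a As Bs a0 (Suc n) =
     metric_projection (As (Suc n)) (metric_projection (Bs (Suc n)) (perturbed_a As Bs a0 n))"

definition perturbed_b ::
  "(nat \<Rightarrow> 'a::metric_space set) \<Rightarrow> (nat \<Rightarrow> 'a set) \<Rightarrow> 'a \<Rightarrow> nat \<Rightarrow> 'a" where
  "perturbed_b As Bs a0 n = metric_projection (Bs n) (perturbed_a As Bs a0 (n - 1))"

lemma perturbed_a_eq:
  "n \<ge> 1 \<Longrightarrow> perturbed_a As Bs a0 n = metric_projection (As n) (perturbed_b As Bs a0 n)"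
  by (cases n) (simp_all add: perturbed_b_def)

text \<open>Intended for closed convex \<open>A\<close> and \<open>B\<close> with nonempty intersection.\<close>

definition stable_couple :: "'a::{real_inner,banach} set \<Rightarrow> 'a set \<Rightarrow> bool" where
  "stable_couple A B \<longleftrightarrow>
     (\<forall>As Bs a0.
        (\<forall>n\<ge>1. As n \<noteq> {} \<and> closed (As n) \<and> convex (As n)) \<longrightarrow>
        (\<forall>n\<ge>1. Bs n \<noteq> {} \<and> closed (Bs n) \<and> convex (Bs n)) \<longrightarrow>
        aw_converges As A \<longrightarrow> aw_converges Bs B \<longrightarrow>
        convergent (perturbed_a As Bs a0) \<and> convergent (perturbed_b As Bs a0))"

end

theory Submission
  imports Defs
begin

text \<open>
  If a convex set \<open>K\<close> contains \<open>cball c r\<close> and \<open>y\<close> is the projection of \<open>x\<close> onto \<open>K\<close>, then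
  testing the obtuse-angle characterisation of \<open>y\<close> with the point of the ball lying farthest
  in the direction \<open>x - y\<close> gives
  \<open>2 r \<parallel>x - y\<parallel> \<le> \<parallel>x - c\<parallel>\<^sup>2 - \<parallel>y - c\<parallel>\<^sup>2\<close> (\<open>projection_step_le\<close>).
  Along successive projections onto sets that all contain \<open>cball c r\<close> the right-hand sides
  telescope, so the trajectory has finite length and is Cauchy.

  A common ball exists: if \<open>cball c (2 * r) \<subseteq> A \<inter> B\<close>, then \<open>cball c r\<close> is contained in
  \<open>A\<^sub>n\<close> and \<open>B\<^sub>n\<close> for all large \<open>n\<close>, because a point \<open>x\<close> of this ball outside the closed
  convex set \<open>A\<^sub>n\<close> could be moved by \<open>r\<close> away from \<open>A\<^sub>n\<close>, giving a point of \<open>A\<close> at distance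
  at least \<open>r\<close> from \<open>A\<^sub>n\<close> and in a bounded region fixed in advance
  (\<open>eventually_cball_subset\<close>). Since finitely many initial steps are irrelevant to
  convergence, the theorem follows.
\<close>

section \<open>Metric projections in Hilbert space\<close>

lemma midpoint_parallelogram:
  fixes x y z :: "'a::real_inner"
  shows "(dist y z)\<^sup>2 = 2 * (dist x y)\<^sup>2 + 2 * (dist x z)\<^sup>2 - 4 * (dist x (midpoint y z))\<^sup>2"
  unfolding dist_norm midpoint_def power2_norm_eq_inner
  by (simp add: algebra_simps inner_commute)

text \<open>
  By the parallelogram identity, the points of \<open>K\<close> whose distance to \<open>x\<close> is almost minimal
  form closed sets with diameter tending to \<open>0\<close>; completeness gives a common point.
\<close>

lemma ex_closest_point_of_convex:
  fixes K :: "'a::{real_inner,banach} set"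
  assumes "K \<noteq> {}" "closed K" "convex K"
  obtains y where "y \<in> K" "\<And>z. z \<in> K \<Longrightarrow> dist x y \<le> dist x z"
proof -
  define d where "d = infdist x K"
  define S where "S = (\<lambda>n. {y\<in>K. (dist x y)\<^sup>2 \<le> d\<^sup>2 + 1 / real (Suc n)})"
  have d0: "0 \<le> d" by (simp add: d_def infdist_nonneg)
  have d_le: "d\<^sup>2 \<le> (dist x y)\<^sup>2" if "y \<in> K" for y
    using infdist_le[OF that, of x] d0 by (simp add: d_def power_mono)
  have closed_S: "closed (S n)" for n
  proof -
    have "S n = K \<inter> {y. (dist x y)\<^sup>2 \<le> d\<^sup>2 + 1 / real (Suc n)}"
      by (auto simp: S_def)
    then show ?thesis
      using assms(2) by (auto intro!: closed_Int closed_Collect_le continuous_on_power continuous_on_dist)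
  qed
  have nonempty_S: "S n \<noteq> {}" for n
  proof -
    have "d < sqrt (d\<^sup>2 + 1 / real (Suc n))"
      by (intro real_less_rsqrt) simp
    then obtain y where y: "y \<in> K" "dist x y < sqrt (d\<^sup>2 + 1 / real (Suc n))"
      using assms(1) by (auto simp: d_def infdist_def cINF_less_iff)
    then have "(dist x y)\<^sup>2 \<le> (sqrt (d\<^sup>2 + 1 / real (Suc n)))\<^sup>2"
      by (intro power_mono) auto
    then show ?thesis using y(1) by (auto simp: S_def)
  qed
  have anti_S: "S n \<subseteq> S m" if "m \<le> n" for m n
  proof -
    have "1 / real (Suc n) \<le> 1 / real (Suc m)"
      using that by (simp add: frac_le)
    then show ?thesis by (auto simp: S_def)
  qed
  have small_S: "\<exists>n. \<forall>y\<in>S n. \<forall>z\<in>S n. dist y z < e" if e: "e > 0" for e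
  proof -
    obtain n where n: "1 / real (Suc n) < e\<^sup>2 / 4"
      using e nat_approx_posE[of "e\<^sup>2 / 4"] by auto
    have "dist y z < e" if yz: "y \<in> S n" "z \<in> S n" for y z
    proof -
      have "midpoint y z \<in> K"
        using yz assms(3) closed_segment_subset[of y K z] midpoint_in_closed_segment[of y z]
        by (auto simp: S_def)
      then have "d\<^sup>2 \<le> (dist x (midpoint y z))\<^sup>2"
        by (rule d_le)
      then have "(dist y z)\<^sup>2 < e\<^sup>2"
        using yz n midpoint_parallelogram[of y z x] by (auto simp: S_def)
      then show ?thesis using e by (simp add: power2_less_imp_less)
    qed
    then show ?thesis by blast
  qed
  obtain y where y: "\<And>n. y \<in> S n"
    using decreasing_closed_nest[of S] closed_S nonempty_S anti_S small_S by metis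
  have "(\<lambda>n. d\<^sup>2 + 1 / real (Suc n)) \<longlonglongrightarrow> d\<^sup>2 + 0"
    by (intro tendsto_intros LIMSEQ_Suc[OF lim_1_over_n])
  then have "(dist x y)\<^sup>2 \<le> d\<^sup>2"
    using y by (intro LIMSEQ_le_const[where X = "\<lambda>n. d\<^sup>2 + 1 / real (Suc n)"])
      (auto simp: S_def)
  then have "dist x y \<le> d"
    using d0 by (rule power2_le_imp_le)
  then have "dist x y \<le> dist x z" if "z \<in> K" for z
    using infdist_le[OF that, of x] by (simp add: d_def)
  moreover have "y \<in> K" using y[of 0] by (simp add: S_def)
  ultimately show ?thesis using that by blast
qed

lemma metric_projection_closest:
  fixes K :: "'a::{real_inner,banach} set"
  assumes "K \<noteq> {}" "closed K" "convex K"
  shows metric_projection_in: "metric_projection K x \<in> K"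
    and metric_projection_le: "z \<in> K \<Longrightarrow> dist x (metric_projection K x) \<le> dist x z"
proof -
  obtain y where "y \<in> K" "\<And>z. z \<in> K \<Longrightarrow> dist x y \<le> dist x z"
    using ex_closest_point_of_convex assms by blast
  then have "\<exists>!y. y \<in> K \<and> (\<forall>z\<in>K. dist x y \<le> dist x z)"
    using any_closest_point_unique[OF assms(3,2)] by blast
  from theI'[OF this]
  show "metric_projection K x \<in> K"
    and "z \<in> K \<Longrightarrow> dist x (metric_projection K x) \<le> dist x z"
    unfolding metric_projection_def by blast+
qed

lemma metric_projection_dot:
  fixes K :: "'a::{real_inner,banach} set"
  assumes "K \<noteq> {}" "closed K" "convex K" "z \<in> K"
  shows "inner (x - metric_projection K x) (z - metric_projection K x) \<le> 0"
  using any_closest_point_dot[OF assms(3,2) metric_projection_in[OF assms(1-3)] assms(4)]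
    metric_projection_le[OF assms(1-3)] by blast

text \<open>
  Projecting onto a convex set with a ball around \<open>c\<close> inside brings the point closer to \<open>c\<close>
  by an amount that controls the length of the step linearly.
\<close>

lemma projection_step_le:
  fixes K :: "'a::{real_inner,banach} set"
  assumes "closed K" "convex K" "cball c r \<subseteq> K" "0 < r"
  shows "2 * r * dist x (metric_projection K x)
           \<le> (dist x c)\<^sup>2 - (dist (metric_projection K x) c)\<^sup>2"
proof -
  define y where "y = metric_projection K x"
  define z where "z = c + r *\<^sub>R sgn (x - y)"
  have "z \<in> cball c r"
    using assms(4) by (simp add: z_def dist_norm norm_sgn)
  then have "z \<in> K" using assms(3) by blast
  then have "inner (x - y) (z - y) \<le> 0"
    using metric_projection_dot[of K z x] assms(1,2) unfolding y_def by blast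
  moreover have "inner (x - y) (sgn (x - y)) = norm (x - y)"
    by (cases "x = y")
      (simp_all add: sgn_div_norm power2_norm_eq_inner[symmetric] power2_eq_square)
  ultimately have "r * norm (x - y) \<le> inner (x - y) (y - c)"
    by (simp add: z_def inner_diff_right inner_add_right)
  moreover have "(norm (x - c))\<^sup>2
      = (norm (x - y))\<^sup>2 + 2 * inner (x - y) (y - c) + (norm (y - c))\<^sup>2"
    unfolding power2_norm_eq_inner by (simp add: algebra_simps inner_commute)
  ultimately show ?thesis
    unfolding y_def[symmetric] dist_norm using zero_le_power2[of "norm (x - y)"] by linarith
qed

section \<open>Balls inside Attouch-Wets approximants\<close>

lemma infdist_le_aw_dist:
  fixes A C :: "'a::real_normed_vector set"
  assumes "a \<in> A" "norm a \<le> real N" "C \<noteq> {}"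
  shows "infdist a C \<le> aw_dist N C A"
proof -
  obtain c where c: "c \<in> C" using assms(3) by blast
  have "infdist u C \<le> real N + norm c" if "norm u \<le> real N" for u
    using infdist_le[OF c, of u] norm_triangle_ineq4[of u c] that by (simp add: dist_norm)
  then have "bdd_above ((\<lambda>a. infdist a C) ` {a\<in>A. norm a \<le> real N})"
    by (intro bdd_aboveI2[where M = "real N + norm c"]) auto
  then have "infdist a C \<le> (SUP a\<in>{a\<in>A. norm a \<le> real N}. infdist a C)"
    using assms(1,2) by (intro cSUP_upper) auto
  moreover have "A \<inter> cball 0 (real N) \<noteq> {}" using assms(1,2) by auto
  ultimately show ?thesis by (simp add: aw_dist_def aw_excess_def)
qed

text \<open>The direction \<open>u\<close> points from the projection of \<open>x\<close> onto \<open>K\<close> towards \<open>x\<close>.\<close>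

lemma far_point_of_notin:
  fixes K :: "'a::{real_inner,banach} set"
  assumes "K \<noteq> {}" "closed K" "convex K" "x \<notin> K"
  obtains u where "norm u = 1" "\<And>t. t \<le> infdist (x + t *\<^sub>R u) K"
proof -
  define y where "y = metric_projection K x"
  define u where "u = sgn (x - y)"
  have "y \<in> K" unfolding y_def by (rule metric_projection_in[OF assms(1-3)])
  then have "x \<noteq> y" using assms(4) by blast
  then have u1: "norm u = 1" by (simp add: u_def norm_sgn)
  have xy: "x - y = norm (x - y) *\<^sub>R u"
    using \<open>x \<noteq> y\<close> by (simp add: u_def sgn_div_norm)
  have "t \<le> dist (x + t *\<^sub>R u) z" if z: "z \<in> K" for t z
  proof -
    have "inner (x - y) (z - y) \<le> 0"
      unfolding y_def by (rule metric_projection_dot[OF assms(1-3) z])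
    then have "0 \<le> inner u (y - z)"
      by (simp add: u_def sgn_div_norm inner_diff_right mult_left_mono)
    moreover have eq: "x + t *\<^sub>R u - z = norm (x - y) *\<^sub>R u + t *\<^sub>R u + (y - z)"
      using xy by (simp add: algebra_simps)
    moreover have "inner u (x + t *\<^sub>R u - z) = norm (x - y) + t + inner u (y - z)"
      unfolding eq inner_add_right inner_scaleR_right using u1 by (simp add: dot_square_norm)
    moreover have "inner u (x + t *\<^sub>R u - z) \<le> norm (x + t *\<^sub>R u - z)"
      using norm_cauchy_schwarz[of u "x + t *\<^sub>R u - z"] u1 by simp
    ultimately show ?thesis
      using norm_ge_zero[of "x - y"] unfolding dist_norm by linarith
  qed
  then have "t \<le> infdist (x + t *\<^sub>R u) K" for t
    using assms(1) by (auto simp: infdist_def intro: cINF_greatest)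
  then show ?thesis using that u1 by blast
qed

lemma eventually_cball_subset:
  fixes A :: "'a::{real_inner,banach} set"
  assumes As: "\<And>n. n \<ge> 1 \<Longrightarrow> As n \<noteq> {} \<and> closed (As n) \<and> convex (As n)"
    and lim: "aw_converges As A"
    and A: "cball c (2 * r) \<subseteq> A" and r: "0 < r"
  shows "\<forall>\<^sub>F n in sequentially. cball c r \<subseteq> As n"
proof -
  \<comment> \<open>A radius bounding all of \<open>cball c (2 * r)\<close>.\<close>
  define N where "N = Suc (nat \<lceil>norm c + 2 * r\<rceil>)"
  have N: "norm c + 2 * r \<le> real N" unfolding N_def by linarith
  have "(\<lambda>n. aw_dist N (As n) A) \<longlonglongrightarrow> 0"
    using lim by (simp add: aw_converges_def N_def)
  then have "\<forall>\<^sub>F n in sequentially. aw_dist N (As n) A < r"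
    using r by (rule order_tendstoD)
  then show ?thesis
    using eventually_ge_at_top[of 1]
  proof eventually_elim
    case (elim n)
    show ?case
    proof (rule ccontr)
      assume "\<not> cball c r \<subseteq> As n"
      then obtain x where x: "dist c x \<le> r" "x \<notin> As n" by (meson mem_cball subsetI)
      obtain u where u: "norm u = 1" "r \<le> infdist (x + r *\<^sub>R u) (As n)"
        using far_point_of_notin[of "As n" x] As[OF elim(2)] x(2) by metis
      have d: "dist c (x + r *\<^sub>R u) \<le> 2 * r"
        using x(1) u(1) r norm_triangle_ineq4[of "c - x" "r *\<^sub>R u"]
        by (simp add: dist_norm algebra_simps)
      then have "x + r *\<^sub>R u \<in> A" using A by auto
      moreover have "norm (x + r *\<^sub>R u) \<le> real N"
        using d N norm_triangle_ineq3[of c "x + r *\<^sub>R u"] by (simp add: dist_norm)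
      ultimately have "infdist (x + r *\<^sub>R u) (As n) \<le> aw_dist N (As n) A"
        using As[OF elim(2)] by (intro infdist_le_aw_dist) auto
      then show False using u(2) elim(1) by linarith
    qed
  qed
qed

section \<open>Trajectories of finite length\<close>

text \<open>
  From index \<open>m\<close> on, \<open>f n\<close> bounds the length of the remaining trajectory; the second
  conclusion makes the intermediate points of each two-step move converge to the same limit.
\<close>

lemma convergent_if_dist_le_decrease:
  fixes x :: "nat \<Rightarrow> 'a::complete_space" and f :: "nat \<Rightarrow> real"
  assumes step: "\<And>n. n \<ge> m \<Longrightarrow> dist (x n) (x (Suc n)) \<le> f n - f (Suc n)"
    and f0: "\<And>n. 0 \<le> f n"
  shows "convergent x" and "(\<lambda>n. f n - f (Suc n)) \<longlonglongrightarrow> 0"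
proof -
  have "decseq (\<lambda>n. f (n + m))"
  proof (rule decseq_SucI)
    show "f (Suc n + m) \<le> f (n + m)" for n
      using order_trans[OF zero_le_dist step[of "n + m"]] by simp
  qed
  then obtain l where "(\<lambda>n. f (n + m)) \<longlonglongrightarrow> l"
    using decseq_convergent[of "\<lambda>n. f (n + m)" 0] f0 by blast
  then have l: "f \<longlonglongrightarrow> l" by (rule LIMSEQ_offset)
  show "(\<lambda>n. f n - f (Suc n)) \<longlonglongrightarrow> 0"
    using tendsto_diff[OF l LIMSEQ_Suc[OF l]] by simp
  have sum: "dist (x n) (x (n + k)) \<le> f n - f (n + k)" if "n \<ge> m" for n k
  proof (induction k)
    case (Suc k)
    then show ?case
      using step[of "n + k"] that dist_triangle[of "x n" "x (Suc (n + k))" "x (n + k)"]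
      by simp
  qed simp
  have "Cauchy x"
    unfolding Cauchy_altdef2
  proof (intro allI impI)
    fix e :: real assume e: "e > 0"
    obtain M where M: "\<And>i j. i \<ge> M \<Longrightarrow> j \<ge> M \<Longrightarrow> dist (f i) (f j) < e"
      using metric_CauchyD[OF LIMSEQ_imp_Cauchy[OF l] e] by blast
    have "dist (x n) (x (max m M)) < e" if "n \<ge> max m M" for n
    proof -
      have "dist (x (max m M)) (x n) \<le> f (max m M) - f n"
        using sum[of "max m M" "n - max m M"] that by simp
      also have "\<dots> < e" using M[of "max m M" n] that abs_ge_self[of "f (max m M) - f n"]
        unfolding dist_real_def by simp
      finally show ?thesis by (simp add: dist_commute)
    qed
    then show "\<exists>K. \<forall>n\<ge>K. dist (x n) (x K) < e" by blast
  qed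
  then show "convergent x" by (simp add: Cauchy_convergent_iff)
qed

theorem theorem4p2:
  fixes A B :: "'a::{real_inner,banach} set"
  assumes "A \<noteq> {}" and "closed A" and "convex A"
    and "B \<noteq> {}" and "closed B" and "convex B"
    and "interior (A \<inter> B) \<noteq> {}"
  shows "stable_couple A B"
  unfolding stable_couple_def
proof (intro allI impI)
  fix As Bs :: "nat \<Rightarrow> 'a set" and a0 :: 'a
  assume As: "\<forall>n\<ge>1. As n \<noteq> {} \<and> closed (As n) \<and> convex (As n)"
    and Bs: "\<forall>n\<ge>1. Bs n \<noteq> {} \<and> closed (Bs n) \<and> convex (Bs n)"
    and limA: "aw_converges As A" and limB: "aw_converges Bs B"
  define a where "a = perturbed_a As Bs a0"
  define b where "b = perturbed_b As Bs a0"
  obtain c where "c \<in> interior (A \<inter> B)"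
    using assms(7) by blast
  then obtain s where s: "0 < s" "cball c s \<subseteq> A \<inter> B"
    unfolding mem_interior_cball by blast
  define r where "r = s / 2"
  have r: "0 < r" and rA: "cball c (2 * r) \<subseteq> A" and rB: "cball c (2 * r) \<subseteq> B"
    using s by (auto simp: r_def)
  have "\<forall>\<^sub>F n in sequentially. cball c r \<subseteq> As n \<and> cball c r \<subseteq> Bs n"
    using eventually_cball_subset[OF _ limA rA r] eventually_cball_subset[OF _ limB rB r] As Bs
    by (intro eventually_conj) blast+
  then obtain m where m: "\<And>n. n \<ge> m \<Longrightarrow> cball c r \<subseteq> As n \<and> cball c r \<subseteq> Bs n"
    by (auto simp: eventually_sequentially)
  define f where "f = (\<lambda>n. (dist (a n) c)\<^sup>2 / (2 * r))"
  have two_steps: "dist (a n) (b (Suc n)) + dist (b (Suc n)) (a (Suc n)) \<le> f n - f (Suc n)"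
    if "n \<ge> m" for n
  proof -
    have b: "b (Suc n) = metric_projection (Bs (Suc n)) (a n)"
      and a: "a (Suc n) = metric_projection (As (Suc n)) (b (Suc n))"
      by (simp_all add: a_def b_def perturbed_b_def)
    have balls: "cball c r \<subseteq> As (Suc n)" "cball c r \<subseteq> Bs (Suc n)"
      using m[of "Suc n"] that by auto
    have sets: "closed (As (Suc n))" "convex (As (Suc n))"
      "closed (Bs (Suc n))" "convex (Bs (Suc n))"
      using As Bs by simp_all
    have "2 * r * dist (a n) (b (Suc n)) \<le> (dist (a n) c)\<^sup>2 - (dist (b (Suc n)) c)\<^sup>2"
      unfolding b by (rule projection_step_le[OF sets(3,4) balls(2) r])
    moreover have "2 * r * dist (b (Suc n)) (a (Suc n))
             \<le> (dist (b (Suc n)) c)\<^sup>2 - (dist (a (Suc n)) c)\<^sup>2"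
      unfolding a by (rule projection_step_le[OF sets(1,2) balls(1) r])
    ultimately have "(dist (a n) (b (Suc n)) + dist (b (Suc n)) (a (Suc n))) * (2 * r)
        \<le> (dist (a n) c)\<^sup>2 - (dist (a (Suc n)) c)\<^sup>2"
      by (simp add: algebra_simps)
    then show ?thesis
      using r by (simp add: f_def pos_le_divide_eq flip: diff_divide_distrib)
  qed
  have "dist (a n) (a (Suc n)) \<le> f n - f (Suc n)" if "n \<ge> m" for n
    using two_steps[OF that] dist_triangle[of "a n" "a (Suc n)" "b (Suc n)"] by linarith
  moreover have "0 \<le> f n" for n using r by (simp add: f_def)
  ultimately have a: "convergent a" and f: "(\<lambda>n. f n - f (Suc n)) \<longlonglongrightarrow> 0"
    using convergent_if_dist_le_decrease[of m a f] by auto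
  have "\<forall>\<^sub>F n in sequentially. dist (a n) (b (Suc n)) \<le> f n - f (Suc n)"
    using eventually_ge_at_top[of m]
  proof eventually_elim
    case (elim n)
    then show ?case
      using two_steps[of n] zero_le_dist[of "b (Suc n)" "a (Suc n)"] by linarith
  qed
  then have d: "(\<lambda>n. dist (a n) (b (Suc n))) \<longlonglongrightarrow> 0"
    by (intro tendsto_sandwich[OF _ _ tendsto_const f]) auto
  obtain l where "a \<longlonglongrightarrow> l" using a by (auto simp: convergent_def)
  moreover have "(\<lambda>n. a n - b (Suc n)) \<longlonglongrightarrow> 0"
    using d by (simp add: dist_norm tendsto_norm_zero_iff)
  ultimately have "(\<lambda>n. b (Suc n)) \<longlonglongrightarrow> l" by (rule Lim_transform2)
  then have "convergent b" by (auto simp: convergent_def filterlim_sequentially_Suc)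
  then show "convergent (perturbed_a As Bs a0) \<and> convergent (perturbed_b As Bs a0)"
    using a by (simp add: a_def b_def)
qed

end
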